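(* For every integer $r\ge 1$, setting $m=2r$, there exists a connected graph $G_m$ such that $$\gamma_g(T)-\gamma_g(G_m)\ge r-1$$ holds for every spanning tree $T$ of $G_m$.
   Context: Graphs are finite, simple and nonempty. A spanning tree of $G$ is a subgraph of $G$ that is a tree and has the same vertex set as $G$. For a vertex $v$, $N[v]$ is its closed neighborhood; a chosen vertex $v$ dominates all vertices of $N[v]$. The domination game on a graph $G$ is played by two players, Dominator and Staller, who alternately choose vertices of $G$; each chosen vertex must dominate at least one vertex that was not dominated by the previously chosen vertices. The game ends when all vertices of $G$ are dominated. Dominator wants the total number of chosen vertices to be as small as possible, Staller wants it to be as large as possible. The game domination number $\gamma_g(G)$ is the total number of vertices chosen (by both players) when Dominator makes the first move and both players play optimally. *)

theory Defs
  imports "Graph_Theory.Graph_Theory"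
begin

text \<open>
  A finite simple graph is a \<^locale>\<open>pair_graph\<close>: an undirected edge is the pair of arcs
  \<open>(u, v)\<close>, \<open>(v, u)\<close>. The library's \<^const>\<open>connected\<close> includes nonemptiness. The library's
  \<^const>\<open>tree\<close> and \<^const>\<open>spanning_tree\<close> are about directed cycles, and there every edge of a
  symmetric digraph already gives a cycle \<open>u, v, u\<close> of length 2; so they do not describe trees in
  the sense of undirected graphs. The cycles of a simple graph are exactly the cycles of the
  symmetric digraph that have length at least 3.
\<close>

definition graph_tree :: "'a pair_pre_digraph \<Rightarrow> bool" where
  "graph_tree T \<longleftrightarrow> pair_graph T \<and> connected T \<and>
     \<not> (\<exists>p. pre_digraph.cycle T p \<and> 3 \<le> length p)"

definition graph_spanning_tree :: "'a pair_pre_digraph \<Rightarrow> 'a pair_pre_digraph \<Rightarrow> bool" where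
  "graph_spanning_tree T G \<longleftrightarrow> graph_tree T \<and> spanning T G"

definition closed_nbhd :: "'a pair_pre_digraph \<Rightarrow> 'a \<Rightarrow> 'a set" where
  "closed_nbhd G v = {w \<in> pverts G. w = v \<or> (v, w) \<in> parcs G}"

definition dominated :: "'a pair_pre_digraph \<Rightarrow> 'a set \<Rightarrow> 'a set" where
  "dominated G C = (\<Union>v\<in>C. closed_nbhd G v)"

definition legal_moves :: "'a pair_pre_digraph \<Rightarrow> 'a set \<Rightarrow> 'a set" where
  "legal_moves G C = {v \<in> pverts G. \<not> closed_nbhd G v \<subseteq> dominated G C}"

lemma legal_move_not_chosen: "v \<in> legal_moves G C \<Longrightarrow> v \<notin> C"
  by (auto simp: legal_moves_def dominated_def)

datatype player = Dominator | Staller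

text \<open>
  \<open>moves_left G p C\<close> is the number of moves still to be made under optimal play when the vertices in
  \<open>C\<close> have been chosen and player \<open>p\<close> is to move. While the game is not over, every undominated
  vertex is itself a legal move, so \<open>Min\<close> and \<open>Max\<close> range over finite nonempty sets. The value 0 for
  infinite graphs is a dummy that makes the recursion total.
\<close>

function moves_left :: "'a pair_pre_digraph \<Rightarrow> player \<Rightarrow> 'a set \<Rightarrow> nat" where
  "moves_left G p C =
     (if infinite (pverts G) \<or> pverts G \<subseteq> dominated G C then 0
      else Suc (case p of
          Dominator \<Rightarrow> Min ((\<lambda>v. moves_left G Staller (insert v C)) ` legal_moves G C)
        | Staller \<Rightarrow> Max ((\<lambda>v. moves_left G Dominator (insert v C)) ` legal_moves G C)))"
  by pat_completeness auto

lemma legal_move_decreases: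
  assumes "finite (pverts G)" "v \<in> legal_moves G C"
  shows "card (pverts G - insert v C) < card (pverts G - C)"
proof (rule psubset_card_mono)
  show "finite (pverts G - C)" using assms(1) by simp
  show "pverts G - insert v C \<subset> pverts G - C"
    using assms(2) legal_move_not_chosen[OF assms(2)] by (auto simp: legal_moves_def)
qed

termination
  by (relation "measure (\<lambda>(G, p, C). card (pverts G - C))") (auto simp: legal_move_decreases)

declare moves_left.simps [simp del]

lemma legal_moves_nonempty:
  assumes "\<not> pverts G \<subseteq> dominated G C"
  shows "legal_moves G C \<noteq> {}"
  using assms by (auto simp: legal_moves_def closed_nbhd_def)

definition game_domination_number :: "'a pair_pre_digraph \<Rightarrow> nat" where
  "game_domination_number G = moves_left G Dominator {}"

end

theory Submission
  imports Defs
begin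

text \<open>
  Take \<open>m = 2 * r\<close> disjoint copies of \<open>K\<^sub>4\<close>, mark one vertex in each, and join the marked
  vertices to a clique. Any move in a copy dominates the whole copy, and a second move in a copy
  is legal only if it is the first move on a marked vertex; hence every play on this graph lasts
  at most \<open>m + 1\<close> moves. In a spanning tree, the three unmarked vertices of a copy span no
  triangle, so one of them does not dominate the other two. Staller always opens an untouched copy
  with such a vertex; this copy then takes at least two moves. Staller can do so in \<open>r\<close> copies, and
  the other \<open>r\<close> copies take at least one move each, so the game lasts at least
  \<open>3 * r = (m + 1) + (r - 1)\<close> moves.
\<close>

section \<open>Bounding the length of the game by potentials\<close>

lemma moves_left_over: "pverts G \<subseteq> dominated G C \<Longrightarrow> moves_left G p C = 0"
  by (subst moves_left.simps) simp

lemma finite_legal_moves: "finite (pverts G) \<Longrightarrow> finite (legal_moves G C)"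
  by (simp add: legal_moves_def)

lemma moves_left_Dominator:
  assumes "finite (pverts G)" "\<not> pverts G \<subseteq> dominated G C"
  shows "moves_left G Dominator C =
    Suc (Min ((\<lambda>v. moves_left G Staller (insert v C)) ` legal_moves G C))"
  using assms by (subst moves_left.simps) simp

lemma moves_left_Staller:
  assumes "finite (pverts G)" "\<not> pverts G \<subseteq> dominated G C"
  shows "moves_left G Staller C =
    Suc (Max ((\<lambda>v. moves_left G Dominator (insert v C)) ` legal_moves G C))"
  using assms by (subst moves_left.simps) simp

text \<open>Every legal move of either player costs at least one unit of \<open>\<phi>\<close>, so
  no play can be longer, whatever the strategies. The induction is on \<open>\<phi> C\<close>
  itself.\<close>

lemma moves_left_le_potential:
  fixes \<phi> :: "'a set \<Rightarrow> nat"
  assumes fin: "finite (pverts G)"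
    and step: "\<And>C v. C \<subseteq> pverts G \<Longrightarrow> v \<in> legal_moves G C \<Longrightarrow> \<phi> (insert v C) < \<phi> C"
    and "C \<subseteq> pverts G"
  shows "moves_left G p C \<le> \<phi> C"
  using assms(3)
proof (induction "\<phi> C" arbitrary: p C rule: less_induct)
  case less
  show ?case
  proof (cases "pverts G \<subseteq> dominated G C")
    case True
    then show ?thesis by (simp add: moves_left_over)
  next
    case False
    have fin': "finite (legal_moves G C)" and ne: "legal_moves G C \<noteq> {}"
      using fin False by (auto simp: finite_legal_moves legal_moves_nonempty)
    have IH: "moves_left G q (insert v C) < \<phi> C" if "v \<in> legal_moves G C" for q v
    proof -
      have "insert v C \<subseteq> pverts G"
        using that less.prems by (auto simp: legal_moves_def)
      then show ?thesis
        using less.hyps step[OF less.prems that] by (meson le_less_trans)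
    qed
    show ?thesis
    proof (cases p)
      case Dominator
      obtain v where v: "v \<in> legal_moves G C" using ne by blast
      have "Min ((\<lambda>v. moves_left G Staller (insert v C)) ` legal_moves G C)
          \<le> moves_left G Staller (insert v C)"
        using fin' v by simp
      also have "\<dots> < \<phi> C" using IH v by blast
      finally show ?thesis by (simp add: Dominator moves_left_Dominator fin False)
    next
      case Staller
      have "Max ((\<lambda>v. moves_left G Dominator (insert v C)) ` legal_moves G C) < \<phi> C"
        using fin' ne IH by simp
      then show ?thesis by (simp add: Staller moves_left_Staller fin False)
    qed
  qed
qed

text \<open>This certifies a strategy of Staller: no reply of Dominator may lower
  \<open>\<psi>\<close> by more than one, while Staller needs only one such move. As
  \<open>\<psi>\<close> need not decrease, the induction is on the number of unchosen
  vertices.\<close>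

lemma potential_le_moves_left:
  fixes \<psi> :: "player \<Rightarrow> 'a set \<Rightarrow> nat"
  assumes fin: "finite (pverts G)"
    and over: "\<And>p C. pverts G \<subseteq> dominated G C \<Longrightarrow> \<psi> p C = 0"
    and dom: "\<And>C v. v \<in> legal_moves G C \<Longrightarrow> \<psi> Dominator C \<le> Suc (\<psi> Staller (insert v C))"
    and stal: "\<And>C. \<not> pverts G \<subseteq> dominated G C \<Longrightarrow>
      \<exists>v\<in>legal_moves G C. \<psi> Staller C \<le> Suc (\<psi> Dominator (insert v C))"
  shows "\<psi> p C \<le> moves_left G p C"
proof (induction "card (pverts G - C)" arbitrary: p C rule: less_induct)
  case less
  show ?case
  proof (cases "pverts G \<subseteq> dominated G C")
    case True
    then show ?thesis by (simp add: over)
  next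
    case False
    have fin': "finite (legal_moves G C)" and ne: "legal_moves G C \<noteq> {}"
      using fin False by (auto simp: finite_legal_moves legal_moves_nonempty)
    have IH: "\<psi> q (insert v C) \<le> moves_left G q (insert v C)" if "v \<in> legal_moves G C" for q v
      using less that by (simp add: fin legal_move_decreases)
    show ?thesis
    proof (cases p)
      case Dominator
      have "Min ((\<lambda>v. moves_left G Staller (insert v C)) ` legal_moves G C)
          \<in> (\<lambda>v. moves_left G Staller (insert v C)) ` legal_moves G C"
        using fin' ne by (intro Min_in) auto
      then obtain v where v: "v \<in> legal_moves G C"
        "Min ((\<lambda>v. moves_left G Staller (insert v C)) ` legal_moves G C)
          = moves_left G Staller (insert v C)" by blast
      then show ?thesis
        using dom[OF v(1)] IH[OF v(1), of Staller]
        by (simp add: Dominator moves_left_Dominator fin False)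
    next
      case Staller
      obtain v where v: "v \<in> legal_moves G C" "\<psi> Staller C \<le> Suc (\<psi> Dominator (insert v C))"
        using stal False by blast
      have "moves_left G Dominator (insert v C)
          \<le> Max ((\<lambda>v. moves_left G Dominator (insert v C)) ` legal_moves G C)"
        using fin' v by simp
      then show ?thesis
        using v(2) IH[OF v(1), of Dominator]
        by (simp add: Staller moves_left_Staller fin False)
    qed
  qed
qed

section \<open>A clique of cliques\<close>

text \<open>The copies of \<open>K\<^sub>4\<close> are the fibres of \<open>v div 4\<close>; the marked vertices are the multiples of 4.\<close>

definition clique_of_cliques :: "nat \<Rightarrow> nat pair_pre_digraph" where
  "clique_of_cliques m = \<lparr>pverts = {..<4 * m},
     parcs = {(u, v). u < 4 * m \<and> v < 4 * m \<and> u \<noteq> v \<and> (u div 4 = v div 4 \<or> 4 dvd u \<and> 4 dvd v)}\<rparr>"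

definition untouched :: "nat \<Rightarrow> nat set \<Rightarrow> nat set" where
  "untouched m C = {i. i < m \<and> i \<notin> (\<lambda>v. v div 4) ` C}"

lemma pverts_clique_of_cliques [simp]: "pverts (clique_of_cliques m) = {..<4 * m}"
  by (simp add: clique_of_cliques_def)

lemma parcs_clique_of_cliques: "(u, v) \<in> parcs (clique_of_cliques m) \<longleftrightarrow>
    u < 4 * m \<and> v < 4 * m \<and> u \<noteq> v \<and> (u div 4 = v div 4 \<or> 4 dvd u \<and> 4 dvd v)"
  by (simp add: clique_of_cliques_def)

lemma pair_graph_clique_of_cliques: "pair_graph (clique_of_cliques m)"
proof -
  have "parcs (clique_of_cliques m) \<subseteq> {..<4 * m} \<times> {..<4 * m}"
    by (auto simp: clique_of_cliques_def)
  then have "finite (parcs (clique_of_cliques m))"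
    by (rule finite_subset) simp
  moreover have "sym (parcs (clique_of_cliques m))"
    by (auto simp: clique_of_cliques_def intro: symI)
  ultimately show ?thesis
    by unfold_locales (auto simp: parcs_clique_of_cliques symmetric_def)
qed

lemma connected_clique_of_cliques:
  assumes "m > 0"
  shows "connected (clique_of_cliques m)"
proof -
  let ?G = "clique_of_cliques m"
  interpret pair_graph ?G by (rule pair_graph_clique_of_cliques)
  have adj: "u \<rightarrow>\<^sup>*\<^bsub>?G\<^esub> v"
    if "u < 4 * m" "v < 4 * m" "u div 4 = v div 4 \<or> 4 dvd u \<and> 4 dvd v" for u v
    using that by (cases "u = v") (auto simp: parcs_clique_of_cliques)
  show ?thesis
  proof (rule connectedI)
    show "pverts ?G \<noteq> {}" using assms by (simp add: lessThan_empty_iff)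
  next
    fix u v assume "u \<in> pverts ?G" "v \<in> pverts ?G"
    then have uv: "u < 4 * m" "v < 4 * m" by simp_all
    \<comment> \<open>\<open>?c w\<close> is the marked vertex of the copy of \<open>w\<close>; the
      walk goes from \<open>u\<close> to \<open>v\<close> through \<open>?c u\<close> and
      \<open>?c v\<close>.\<close>
    let ?c = "\<lambda>w. 4 * (w div 4) :: nat"
    have c: "?c u < 4 * m" "?c v < 4 * m" using uv by simp_all
    have "u \<rightarrow>\<^sup>*\<^bsub>?G\<^esub> ?c u" by (rule adj) (use uv c in simp_all)
    also have "\<dots> \<rightarrow>\<^sup>*\<^bsub>?G\<^esub> ?c v" by (rule adj) (use c in simp_all)
    also have "\<dots> \<rightarrow>\<^sup>*\<^bsub>?G\<^esub> v" by (rule adj) (use uv c in simp_all)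
    finally show "u \<rightarrow>\<^sup>*\<^bsub>mk_symmetric ?G\<^esub> v" by (rule reachable_mk_symmetricI)
  qed
qed

lemma finite_untouched [simp]: "finite (untouched m C)"
  by (simp add: untouched_def)

lemma untouched_insert: "untouched m (insert v C) = untouched m C - {v div 4}"
  by (auto simp: untouched_def)

lemma game_domination_number_clique_of_cliques_le:
  "game_domination_number (clique_of_cliques m) \<le> m + 1"
proof -
  let ?G = "clique_of_cliques m"
  \<comment> \<open>The second summand pays for the only possible move in a touched copy: the first
    choice of a marked vertex.\<close>
  define \<phi> where "\<phi> C = card (untouched m C) + (if \<exists>c\<in>C. 4 dvd c then 0 else 1)" for C
  have "\<phi> (insert v C) < \<phi> C" if C: "C \<subseteq> pverts ?G" and v: "v \<in> legal_moves ?G C" for C v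
  proof (cases "v div 4 \<in> untouched m C")
    case True
    then have "card (untouched m (insert v C)) < card (untouched m C)"
      unfolding untouched_insert by (intro card_Diff1_less) auto
    then show ?thesis by (auto simp: \<phi>_def)
  next
    case False
    have "v < 4 * m" using v by (simp add: legal_moves_def)
    then obtain c where c: "c \<in> C" "c div 4 = v div 4"
      using False by (auto simp: untouched_def)
    obtain w where w: "w \<in> closed_nbhd ?G v" "w \<notin> dominated ?G C"
      using v by (auto simp: legal_moves_def)
    \<comment> \<open>Here \<open>C \<subseteq> pverts ?G\<close> matters: arcs at \<open>d\<close>
      exist only for \<open>d < 4 * m\<close>.\<close>
    have undom: "w \<noteq> d \<and> d div 4 \<noteq> w div 4 \<and> \<not> (4 dvd d \<and> 4 dvd w)" if "d \<in> C" for d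
      using w(1) w(2) that C
      by (auto simp: dominated_def closed_nbhd_def parcs_clique_of_cliques)
    \<comment> \<open>The vertex \<open>c\<close> already dominates the copy of \<open>v\<close>, so
      \<open>w\<close> lies in another copy, and only edges between marked vertices lead
      there.\<close>
    have "4 dvd v \<and> 4 dvd w"
      using w(1) undom[OF c(1)] c(2)
      by (auto simp: closed_nbhd_def parcs_clique_of_cliques)
    moreover from this have "\<not> (\<exists>d\<in>C. 4 dvd d)" using undom by blast
    moreover have "untouched m (insert v C) = untouched m C"
      using False by (simp add: untouched_insert)
    ultimately show ?thesis by (simp add: \<phi>_def)
  qed
  then have "moves_left ?G Dominator {} \<le> \<phi> {}"
    by (intro moves_left_le_potential) auto
  also have "\<phi> {} = m + 1" by (simp add: \<phi>_def untouched_def)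
  finally show ?thesis by (simp add: game_domination_number_def)
qed

section \<open>Spanning trees\<close>

lemma graph_tree_no_triangle:
  assumes "graph_tree T" "(u, v) \<in> parcs T" "(v, w) \<in> parcs T" "(w, u) \<in> parcs T"
  shows False
proof -
  interpret pair_graph T using assms(1) by (simp add: graph_tree_def)
  have "u \<noteq> v" "v \<noteq> w" "w \<noteq> u" "u \<in> pverts T"
    using assms(2-4) by (auto dest: no_loops' in_arcsD1)
  then have "cycle [(u, v), (v, w), (w, u)]"
    using assms(2-4) by (auto simp: cycle_def awalk_def)
  then show False using assms(1) by (force simp: graph_tree_def)
qed

definition inner :: "nat \<Rightarrow> nat set" where
  "inner i = {v. v div 4 = i \<and> \<not> 4 dvd v}"

lemma inner_memI: "0 < k \<Longrightarrow> k < 4 \<Longrightarrow> 4 * i + k \<in> inner i"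
  by (simp add: inner_def dvd_eq_mod_eq_0)

text \<open>Marked vertices are left out because they can be dominated from other copies; this way a
  move affects only the status of its own copy.\<close>

definition unfinished :: "nat pair_pre_digraph \<Rightarrow> nat \<Rightarrow> nat set \<Rightarrow> nat set" where
  "unfinished T m C = {i. i < m \<and> \<not> inner i \<subseteq> dominated T C}"

lemma finite_unfinished [simp]: "finite (unfinished T m C)"
  by (simp add: unfinished_def)

context
  fixes T m
  assumes tree: "graph_spanning_tree T (clique_of_cliques m)"
begin

lemma pverts_tree: "pverts T = {..<4 * m}"
  and parcs_tree: "parcs T \<subseteq> parcs (clique_of_cliques m)"
  using tree unfolding graph_spanning_tree_def spanning_def subgraph_def by simp_all

text \<open>Arcs of \<open>T\<close> are arcs of the clique of cliques, where edges between
  different copies have both ends marked.\<close>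

lemma inner_dominated_block:
  assumes "w \<in> inner i" "w \<in> closed_nbhd T v"
  shows "v div 4 = i"
proof -
  have w: "w div 4 = i" "\<not> 4 dvd w" using assms(1) by (simp_all add: inner_def)
  have "w = v \<or> (v, w) \<in> parcs (clique_of_cliques m)"
    using assms(2) parcs_tree unfolding closed_nbhd_def by blast
  then show ?thesis unfolding parcs_clique_of_cliques using w by blast
qed

lemma unfinished_insert: "unfinished T m C - {v div 4} \<subseteq> unfinished T m (insert v C)"
proof
  fix i assume i: "i \<in> unfinished T m C - {v div 4}"
  then obtain w where w: "w \<in> inner i" "w \<notin> dominated T C"
    by (auto simp: unfinished_def)
  have "w \<notin> closed_nbhd T v" using inner_dominated_block[OF w(1)] i by blast
  then have "w \<notin> dominated T (insert v C)" using w(2) by (simp add: dominated_def)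
  then show "i \<in> unfinished T m (insert v C)" using i w(1) by (auto simp: unfinished_def)
qed

lemma untouched_inner_not_dominated:
  assumes "i \<in> untouched m C" "w \<in> inner i"
  shows "w \<notin> dominated T C"
proof
  assume "w \<in> dominated T C"
  then obtain v where "v \<in> C" "w \<in> closed_nbhd T v" by (auto simp: dominated_def)
  with inner_dominated_block[OF assms(2)] have "i \<in> (\<lambda>v. v div 4) ` C" by blast
  with assms(1) show False by (simp add: untouched_def)
qed

lemma untouched_subset_unfinished: "untouched m C \<subseteq> unfinished T m C"
proof
  fix i assume i: "i \<in> untouched m C"
  then have "4 * i + 1 \<notin> dominated T C"
    by (rule untouched_inner_not_dominated) (rule inner_memI; simp)
  then show "i \<in> unfinished T m C"
    using i inner_memI[of 1 i] by (auto simp: unfinished_def untouched_def)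
qed

text \<open>Otherwise the three unmarked vertices would be pairwise adjacent and form a triangle in
  the tree.\<close>

lemma ex_inner_not_dominating: "\<exists>v\<in>inner i. \<not> inner i \<subseteq> closed_nbhd T v"
proof (rule ccontr)
  assume "\<not> ?thesis"
  then have all: "(v, w) \<in> parcs T" if "v \<in> inner i" "w \<in> inner i" "v \<noteq> w" for v w
    using that by (auto simp: closed_nbhd_def)
  have inner: "4 * i + 1 \<in> inner i" "4 * i + 2 \<in> inner i" "4 * i + 3 \<in> inner i"
    by (rule inner_memI; simp)+
  have "graph_tree T" using tree by (simp add: graph_spanning_tree_def)
  then show False
    by (rule graph_tree_no_triangle[of T "4 * i + 1" "4 * i + 2" "4 * i + 3"])
      (use inner in \<open>auto intro!: all\<close>)
qed

text \<open>Staller picks an unmarked \<open>v\<close> that misses some unmarked \<open>w\<close> of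
  the same copy. The move is legal as \<open>v\<close> itself is undominated, and \<open>w\<close>
  keeps the copy unfinished.\<close>

lemma Staller_opens_block:
  assumes i: "i \<in> untouched m C"
  obtains v where "v \<in> legal_moves T C" "v div 4 = i"
    "unfinished T m (insert v C) = unfinished T m C"
proof -
  obtain v w where v: "v \<in> inner i" and w: "w \<in> inner i" "w \<notin> closed_nbhd T v"
    using ex_inner_not_dominating by blast
  have "v < 4 * m" and vi: "v div 4 = i"
    using i v by (auto simp: inner_def untouched_def)
  then have "v \<in> closed_nbhd T v" "v \<in> pverts T"
    by (auto simp: closed_nbhd_def pverts_tree)
  then have "v \<in> legal_moves T C"
    using untouched_inner_not_dominated[OF i v] by (auto simp: legal_moves_def)
  moreover have "w \<notin> dominated T (insert v C)"
    using untouched_inner_not_dominated[OF i w(1)] w(2) by (auto simp: dominated_def)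
  then have "i \<in> unfinished T m (insert v C)"
    using w(1) i by (auto simp: unfinished_def untouched_def)
  then have "unfinished T m C \<subseteq> unfinished T m (insert v C)"
    using unfinished_insert[of C v] vi by blast
  then have "unfinished T m (insert v C) = unfinished T m C"
    by (auto simp: unfinished_def dominated_def)
  ultimately show thesis using vi that by blast
qed

lemma card_unfinished_insert:
  "card (unfinished T m C) \<le> Suc (card (unfinished T m (insert v C)))"
proof -
  have "unfinished T m C \<subseteq> insert (v div 4) (unfinished T m (insert v C))"
    using unfinished_insert by blast
  then have "card (unfinished T m C) \<le> card (insert (v div 4) (unfinished T m (insert v C)))"
    by (intro card_mono) auto
  also have "\<dots> \<le> Suc (card (unfinished T m (insert v C)))"
    by (rule card_insert_le_m1[of "Suc _", simplified]) simp
  finally show ?thesis .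
qed

lemma le_game_domination_number_tree: "m + m div 2 \<le> game_domination_number T"
proof -
  \<comment> \<open>Each unfinished copy needs one more move, and each untouched copy opened by
    Staller costs an extra one. If the players open \<open>k\<close> untouched copies in turn,
    Staller gets \<open>k div 2\<close> of them when Dominator begins and
    \<open>(k + 1) div 2\<close> when Staller begins.\<close>
  define \<psi> where "\<psi> p C = card (unfinished T m C) +
      (case p of Dominator \<Rightarrow> card (untouched m C) div 2
        | Staller \<Rightarrow> (card (untouched m C) + 1) div 2)" for p C
  have "\<psi> Dominator {} \<le> moves_left T Dominator {}"
  proof (rule potential_le_moves_left)
    show "finite (pverts T)" by (simp add: pverts_tree)
  next
    fix p C assume "pverts T \<subseteq> dominated T C"
    then have "unfinished T m C = {}"
      by (auto simp: unfinished_def pverts_tree inner_def subset_iff)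
    moreover from this have "untouched m C = {}"
      using untouched_subset_unfinished by blast
    ultimately show "\<psi> p C = 0" by (simp add: \<psi>_def split: player.split)
  next
    fix C v assume "v \<in> legal_moves T C"
    have "card (untouched m C) \<le> Suc (card (untouched m (insert v C)))"
      by (auto simp: untouched_insert card_Diff_singleton_if)
    then have "card (untouched m C) div 2 \<le> (card (untouched m (insert v C)) + 1) div 2"
      by (intro div_le_mono) simp
    then show "\<psi> Dominator C \<le> Suc (\<psi> Staller (insert v C))"
      using card_unfinished_insert[of C v] by (simp add: \<psi>_def)
  next
    fix C assume "\<not> pverts T \<subseteq> dominated T C"
    show "\<exists>v\<in>legal_moves T C. \<psi> Staller C \<le> Suc (\<psi> Dominator (insert v C))"
    proof (cases "untouched m C = {}")
      case True
      \<comment> \<open>With no untouched copy left, the second summand is 0 for both players, so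
        any legal move will do.\<close>
      obtain v where v: "v \<in> legal_moves T C"
        using legal_moves_nonempty[OF \<open>\<not> pverts T \<subseteq> dominated T C\<close>] by blast
      then show ?thesis
        using card_unfinished_insert[of C v] True
        by (intro bexI[OF _ v]) (simp add: \<psi>_def untouched_insert)
    next
      case False
      then obtain i where i: "i \<in> untouched m C" by blast
      then obtain v where v: "v \<in> legal_moves T C" "v div 4 = i"
        "unfinished T m (insert v C) = unfinished T m C"
        by (rule Staller_opens_block)
      \<comment> \<open>The first summand is unchanged, and the second drops by exactly one, from
        \<open>(k + 1) div 2\<close> to \<open>(k - 1) div 2\<close>.\<close>
      have "card (untouched m C) = Suc (card (untouched m (insert v C)))"
        using card_Suc_Diff1[OF finite_untouched i] v(2) by (simp add: untouched_insert)
      then have "\<psi> Staller C \<le> Suc (\<psi> Dominator (insert v C))"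
        using v(3) by (simp add: \<psi>_def)
      then show ?thesis using v(1) by blast
    qed
  qed
  moreover have "untouched m {} = {..<m}" by (auto simp: untouched_def)
  moreover from this have "unfinished T m {} = {..<m}"
    using untouched_subset_unfinished[of "{}"] by (auto simp: unfinished_def)
  ultimately show ?thesis by (simp add: game_domination_number_def \<psi>_def)
qed

end

theorem theorem4p4:
  fixes r m :: nat
  assumes "r \<ge> 1" and "m = 2 * r"
  shows "\<exists>G_m :: nat pair_pre_digraph. pair_graph G_m \<and> connected G_m \<and>
    (\<forall>T. graph_spanning_tree T G_m \<longrightarrow>
      int (game_domination_number T) - int (game_domination_number G_m) \<ge> int r - 1)"
proof (intro exI conjI allI impI)
  show "pair_graph (clique_of_cliques m)" by (rule pair_graph_clique_of_cliques)
  show "connected (clique_of_cliques m)" using assms by (intro connected_clique_of_cliques) simp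
next
  fix T assume "graph_spanning_tree T (clique_of_cliques m)"
  from le_game_domination_number_tree[OF this] game_domination_number_clique_of_cliques_le[of m]
  show "int (game_domination_number T) - int (game_domination_number (clique_of_cliques m))
      \<ge> int r - 1"
    \<comment> \<open>For \<open>m = 2 * r\<close> the two bounds are \<open>3 * r\<close> and
      \<open>2 * r + 1\<close>.\<close>
    using assms(2) by linarith
qed

end
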